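(* Let $r\ge2$ and define the sequence $\{\alpha_k\}_{k\ge0}$ by $\alpha_0=1$ and $$\alpha_k=\begin{cases}(k+r)/r,&k\text{ even},\\ \big(1+\sqrt{1+4\alpha_{k-1}^2}\big)/2,&k\text{ odd}.\end{cases}$$ Let $\sigma_{k+1}=(\alpha_k-1)/\alpha_{k+1}$. Then $\alpha_k>0$ for all $k$, $\alpha_k=\Omega(k)$, $\lim_k\alpha_{k+1}/\alpha_k=1$, and $\alpha_{k+1}(\alpha_{k+1}-1)\le\alpha_k^2$ for all $k\ge0$. But if $r>2$, then $\lim_kk(1-\sigma_{k+1})$ does not exist: along the even indices $k'=2k$ and odd indices $k''=2k+1$, $$\lim_{k'\to\infty}k'(1-\sigma_{k'+1})=\frac{3r}{2},\qquad\lim_{k''\to\infty}k''(1-\sigma_{k''+1})=2+\frac r2.$$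
   Context: $\alpha_k=\Omega(k)$ means that there are constants $c>0$ and $k_0\ge1$ with $\alpha_k\ge ck$ for all $k\ge k_0$. *)

theory Defs
  imports Complex_Main
begin

fun alpha :: "real \<Rightarrow> nat \<Rightarrow> real" where
  "alpha r 0 = 1"
| "alpha r (Suc k) =
     (if even (Suc k) then (real (Suc k) + r) / r
      else (1 + sqrt (1 + 4 * (alpha r k)\<^sup>2)) / 2)"

text \<open>The sequence is indexed from 1; the value at 0 is a dummy.\<close>

fun sigma :: "real \<Rightarrow> nat \<Rightarrow> real" where
  "sigma r 0 = 0"
| "sigma r (Suc k) = (alpha r k - 1) / alpha r (Suc k)"

end

theory Submission
  imports Defs "HOL-Real_Asymp.Real_Asymp"
begin

text \<open>Even-indexed values are affine, and each odd-indexed value \<open>b\<close> is the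
  positive root of \<open>b * (b - 1) = a\<^sup>2\<close> for the even value \<open>a\<close> before
  it. So the inequality is an equality from even to odd. From odd to even it follows from
  \<open>b \<ge> a + 1/2\<close> and from the step \<open>2 / r\<close> between consecutive even
  values being at most 1, which is where \<open>r \<ge> 2\<close> enters
  (\<open>alpha_Suc_mult_le\<close>). The same bound on \<open>b\<close> gives positivity and linear
  growth (\<open>alpha_ge_linear\<close>). For the limits, let \<open>x\<close> be an even value:
  the next two values are x + 1/2 + O(1/x) and x + 2/r. Hence the ratios tend to 1, while 1 - sigma
  behaves like (3/2)/x at the even index and (2/r + 1/2)/x at the odd one. Since the index is
  asymptotic to r x, the limits are 3r/2 and 2 + r/2, which agree only for r = 2.\<close>

lemma alpha_double:
  assumes "r \<noteq> 0"
  shows "alpha r (2 * k) = 1 + 2 * real k / r"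
  using assms by (cases k) (simp_all add: field_simps)

lemma alpha_double_Suc:
  assumes "r \<noteq> 0"
  shows "alpha r (Suc (2 * k)) = (1 + sqrt (1 + 4 * (1 + 2 * real k / r)\<^sup>2)) / 2"
  using alpha_double[OF assms, of k] by simp

lemma alpha_double_Suc_Suc:
  assumes "r \<noteq> 0"
  shows "alpha r (Suc (Suc (2 * k))) = 1 + 2 * (real k + 1) / r"
  using alpha_double[OF assms, of "Suc k"] by (simp add: algebra_simps)

text \<open>The formula for \<open>b\<close> is the quadratic formula for
  \<open>b * (b - 1) = a\<^sup>2\<close>; dropping the 1 under the root gives the lower
  bound.\<close>

lemma half_one_plus_sqrt_bounds:
  fixes a b :: real
  assumes "a \<ge> 0" and b: "b = (1 + sqrt (1 + 4 * a\<^sup>2)) / 2"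
  shows "b * (b - 1) = a\<^sup>2" and "a + 1/2 \<le> b"
proof -
  have "2 * b - 1 = sqrt (1 + 4 * a\<^sup>2)"
    using b by (simp add: field_simps)
  then have "(2 * b - 1)\<^sup>2 = 1 + 4 * a\<^sup>2"
    by (simp add: add_nonneg_nonneg)
  then show "b * (b - 1) = a\<^sup>2"
    by (simp add: power2_eq_square algebra_simps)
  have "2 * a \<le> sqrt (1 + 4 * a\<^sup>2)"
    by (rule real_le_rsqrt) (simp add: power2_eq_square)
  then show "a + 1/2 \<le> b" using b by simp
qed

lemma alpha_ge_linear:
  assumes "r \<ge> 2"
  shows "1 + real k / r \<le> alpha r k"
proof (cases "even k")
  case True
  then obtain n where "k = 2 * n" by blast
  then show ?thesis using alpha_double[of r n] assms by simp
next
  case False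
  then obtain n where n: "k = Suc (2 * n)" by (auto elim: oddE)
  have "1 + 2 * real n / r + 1/2 \<le> alpha r k"
    unfolding n using assms
    by (intro half_one_plus_sqrt_bounds(2) alpha_double_Suc) auto
  \<comment> \<open>The excess \<open>1 / r\<close> of the odd index is at most 1/2 because
    \<open>r \<ge> 2\<close>.\<close>
  moreover have "real k / r \<le> 2 * real n / r + 1/2"
    using assms by (simp add: n field_simps)
  ultimately show ?thesis by linarith
qed

lemma alpha_pos:
  assumes "r \<ge> 2"
  shows "alpha r k > 0"
proof -
  have "0 \<le> real k / r" using assms by simp
  with alpha_ge_linear[OF assms, of k] show ?thesis by linarith
qed

lemma alpha_Suc_mult_le:
  assumes "r \<ge> 2"
  shows "alpha r (Suc k) * (alpha r (Suc k) - 1) \<le> (alpha r k)\<^sup>2"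
proof (cases "even k")
  case True
  then have "alpha r (Suc k) = (1 + sqrt (1 + 4 * (alpha r k)\<^sup>2)) / 2" by simp
  from half_one_plus_sqrt_bounds(1)[OF less_imp_le[OF alpha_pos[OF assms]] this]
  show ?thesis by simp
next
  case False
  then obtain n where k: "k = Suc (2 * n)" by (auto elim: oddE)
  define a b c where "a = 1 + 2 * real n / r" and "b = alpha r k" and "c = alpha r (Suc k)"
  have a: "a \<ge> 1" using assms by (simp add: a_def)
  have "b = (1 + sqrt (1 + 4 * a\<^sup>2)) / 2"
    unfolding a_def b_def k using assms by (intro alpha_double_Suc) auto
  note b = half_one_plus_sqrt_bounds[OF order_trans[OF zero_le_one a] this]
  have "c = a + 2 / r"
    using alpha_double_Suc_Suc[of r n] assms by (simp add: a_def c_def k add_divide_distrib)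
  then have c: "a \<le> c" "c \<le> a + 1" using assms by auto
  \<comment> \<open>Both factors are compared with their values at \<open>c = a + 1\<close>.\<close>
  have "c * (c - 1) \<le> (a + 1) * a"
    using a c by (intro mult_mono) auto
  \<comment> \<open>Here \<open>b\<^sup>2 = a\<^sup>2 + b\<close> and
    \<open>b \<ge> a\<close>.\<close>
  also have "\<dots> \<le> b\<^sup>2"
    using b by (simp add: power2_eq_square algebra_simps)
  finally show ?thesis by (simp add: b_def c_def)
qed

text \<open>Every index from \<open>2 * N\<close> on is \<open>2 * n\<close> or
  \<open>Suc (2 * n)\<close> with \<open>n \<ge> N\<close>, so a common threshold for the two
  subsequences serves the whole sequence.\<close>

lemma LIMSEQ_even_odd:
  assumes "(\<lambda>n. f (2 * n)) \<longlonglongrightarrow> L" and "(\<lambda>n. f (Suc (2 * n))) \<longlonglongrightarrow> L"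
  shows "f \<longlonglongrightarrow> L"
proof (rule topological_tendstoI)
  fix S assume "open S" "L \<in> S"
  with assms have "\<forall>\<^sub>F n in sequentially. f (2 * n) \<in> S \<and> f (Suc (2 * n)) \<in> S"
    by (intro eventually_conj topological_tendstoD)
  then obtain N where N: "\<And>n. n \<ge> N \<Longrightarrow> f (2 * n) \<in> S \<and> f (Suc (2 * n)) \<in> S"
    by (auto simp: eventually_sequentially)
  have "f k \<in> S" if "k \<ge> 2 * N" for k
    using that N[of "k div 2"] by (cases "even k") (auto elim!: evenE oddE)
  then show "\<forall>\<^sub>F k in sequentially. f k \<in> S"
    by (auto simp: eventually_sequentially)
qed

text \<open>The limits along even and odd indices are limits in the single real variable
  \<open>x = alpha r (2 * n)\<close>, in which \<open>alpha r (2 * n + 2) = x + 2 / r\<close>.\<close>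

lemma filterlim_alpha_double:
  assumes "r > 0"
  shows "filterlim (\<lambda>n. 1 + 2 * real n / r) at_top sequentially"
  using assms by real_asymp

lemma alpha_ratio_tendsto_1:
  assumes "r > 0"
  shows "(\<lambda>k. alpha r (Suc k) / alpha r k) \<longlonglongrightarrow> 1"
proof (rule LIMSEQ_even_odd)
  have r: "r \<noteq> 0" using assms by simp
  note x = filterlim_alpha_double[OF assms]
  have "((\<lambda>x::real. (1 + sqrt (1 + 4 * x\<^sup>2)) / 2 / x) \<longlongrightarrow> 1) at_top"
    by real_asymp
  from filterlim_compose[OF this x]
  show "(\<lambda>n. alpha r (Suc (2 * n)) / alpha r (2 * n)) \<longlonglongrightarrow> 1"
    unfolding alpha_double[OF r] alpha_double_Suc[OF r] .
  have "((\<lambda>x::real. (x + 2 / r) / ((1 + sqrt (1 + 4 * x\<^sup>2)) / 2)) \<longlongrightarrow> 1) at_top"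
    by real_asymp
  from filterlim_compose[OF this x]
  show "(\<lambda>n. alpha r (Suc (Suc (2 * n))) / alpha r (Suc (2 * n))) \<longlonglongrightarrow> 1"
    unfolding alpha_double_Suc_Suc[OF r] alpha_double_Suc[OF r]
    by (simp add: add_divide_distrib distrib_left add_ac)
qed

lemma sigma_even_limit:
  assumes "r > 0"
  shows "(\<lambda>k. real (2 * k) * (1 - sigma r (Suc (2 * k)))) \<longlonglongrightarrow> 3 * r / 2"
proof -
  have r: "r \<noteq> 0" using assms by simp
  have "((\<lambda>x::real. (x - 1) * (1 - (x - 1) / ((1 + sqrt (1 + 4 * x\<^sup>2)) / 2))) \<longlongrightarrow> 3 / 2) at_top"
    by real_asymp
  \<comment> \<open>With \<open>x = 1 + 2 * real n / r\<close>, the index \<open>2 * n\<close>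
    equals \<open>r * (x - 1)\<close>; the factor \<open>r\<close> is restored here.\<close>
  from tendsto_mult_left[OF filterlim_compose[OF this filterlim_alpha_double[OF assms]], of r]
  show ?thesis
    unfolding sigma.simps alpha_double[OF r] alpha_double_Suc[OF r]
    using r by (simp add: mult.assoc[symmetric] mult.commute[of r])
qed

lemma sigma_odd_limit:
  assumes "r > 0"
  shows "(\<lambda>k. real (Suc (2 * k)) * (1 - sigma r (Suc (Suc (2 * k))))) \<longlonglongrightarrow> 2 + r / 2"
proof -
  have r: "r \<noteq> 0" using assms by simp
  \<comment> \<open>The first factor is the odd index divided by \<open>r\<close>, written in terms
    of \<open>x\<close>.\<close>
  define g where
    "g x = (x - 1 + 1 / r) * (1 - ((1 + sqrt (1 + 4 * x\<^sup>2)) / 2 - 1) / (x + 2 / r))" for x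
  \<comment> \<open>Taking \<open>d\<close> for \<open>2 / r\<close> turns \<open>1 / r\<close> into
    \<open>d / 2\<close>, so the expansion involves no division by the parameter.\<close>
  have "((\<lambda>x. (x - 1 + d / 2) * (1 - ((1 + sqrt (1 + 4 * x\<^sup>2)) / 2 - 1) / (x + d)))
      \<longlongrightarrow> d + 1 / 2) at_top" for d :: real
    by (real_asymp simp: field_simps)
  from this[of "2 / r"] have "(g \<longlongrightarrow> 2 / r + 1 / 2) at_top"
    by (simp add: g_def[abs_def])
  from tendsto_mult_left[OF filterlim_compose[OF this filterlim_alpha_double[OF assms]], of r]
  have "(\<lambda>k. r * g (1 + 2 * real k / r)) \<longlonglongrightarrow> 2 + r / 2"
    using r by (simp add: distrib_left)
  moreover have "r * g (1 + 2 * real k / r) =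
      real (Suc (2 * k)) * (1 - sigma r (Suc (Suc (2 * k))))" for k
  proof -
    have "r * (1 + 2 * real k / r - 1 + 1 / r) = real (Suc (2 * k))"
      using r by (simp add: field_simps)
    moreover have "1 + 2 * real k / r + 2 / r = 1 + 2 * (real k + 1) / r"
      by (simp add: add_divide_distrib)
    ultimately show ?thesis
      unfolding g_def sigma.simps(2) alpha_double_Suc_Suc[OF r] alpha_double_Suc[OF r]
      by (simp only: mult.assoc[symmetric])
  qed
  ultimately show ?thesis by simp
qed

theorem lemma1:
  fixes r :: real
  assumes "r \<ge> 2"
  shows "(\<forall>k. alpha r k > 0) \<and>
    (\<exists>c>0. \<exists>k0\<ge>1. \<forall>k\<ge>k0. alpha r k \<ge> c * real k) \<and>
    (\<lambda>k. alpha r (k + 1) / alpha r k) \<longlonglongrightarrow> 1 \<and>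
    (\<forall>k. alpha r (k + 1) * (alpha r (k + 1) - 1) \<le> (alpha r k)\<^sup>2) \<and>
    (r > 2 \<longrightarrow>
      \<not> convergent (\<lambda>k. real k * (1 - sigma r (k + 1))) \<and>
      (\<lambda>k. real (2 * k) * (1 - sigma r (2 * k + 1))) \<longlonglongrightarrow> 3 * r / 2 \<and>
      (\<lambda>k. real (2 * k + 1) * (1 - sigma r ((2 * k + 1) + 1))) \<longlonglongrightarrow> 2 + r / 2)"
proof (intro conjI impI)
  have r: "r > 0" using assms by simp
  show "\<forall>k. alpha r k > 0"
    using alpha_pos[OF assms] by blast
  have "alpha r k \<ge> 1 / r * real k" for k
    using alpha_ge_linear[OF assms, of k] by simp
  then show "\<exists>c>0. \<exists>k0\<ge>1. \<forall>k\<ge>k0. alpha r k \<ge> c * real k"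
    using r by (intro exI[of _ "1 / r"] conjI exI[of _ 1]) auto
  show "(\<lambda>k. alpha r (k + 1) / alpha r k) \<longlonglongrightarrow> 1"
    using alpha_ratio_tendsto_1[OF r] by (simp only: Suc_eq_plus1)
  show "\<forall>k. alpha r (k + 1) * (alpha r (k + 1) - 1) \<le> (alpha r k)\<^sup>2"
    using alpha_Suc_mult_le[OF assms] by (simp only: Suc_eq_plus1 simp_thms)
  show even: "(\<lambda>k. real (2 * k) * (1 - sigma r (2 * k + 1))) \<longlonglongrightarrow> 3 * r / 2"
    using sigma_even_limit[OF r] by (simp only: Suc_eq_plus1)
  show odd: "(\<lambda>k. real (2 * k + 1) * (1 - sigma r ((2 * k + 1) + 1))) \<longlonglongrightarrow> 2 + r / 2"
    using sigma_odd_limit[OF r] by (simp only: Suc_eq_plus1)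
  assume "r > 2"
  show "\<not> convergent (\<lambda>k. real k * (1 - sigma r (k + 1)))"
  proof
    assume "convergent (\<lambda>k. real k * (1 - sigma r (k + 1)))"
    then obtain L where L: "(\<lambda>k. real k * (1 - sigma r (k + 1))) \<longlonglongrightarrow> L"
      by (auto simp: convergent_def)
    have "strict_mono (\<lambda>k::nat. 2 * k)" "strict_mono (\<lambda>k::nat. 2 * k + 1)"
      by (auto simp: strict_mono_def)
    from this[THEN LIMSEQ_subseq_LIMSEQ[OF L], unfolded o_def]
    \<comment> \<open>Both subsequences would inherit the limit \<open>L\<close>, and equating the
      two values forces \<open>r = 2\<close>.\<close>
    have "L = 3 * r / 2" "L = 2 + r / 2"
      using even odd LIMSEQ_unique by blast+
    with \<open>r > 2\<close> show False by simp
  qed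
qed

end
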